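(* Let $N\ge 1$, let $\mathcal{T}_1,\mathcal{T}_2$, the factorization $\mathcal{T}_2=U_iU_o$, the transfer matrix $Y$, the space $\mathcal{Y}$ and, for $\gamma>\|Y\|_\infty$ and $V\in\mathcal{Y}$, the transfer matrices $Y_o$, $R$, $\hat R(V)$ be as in the context, and put $\hat{\mathcal T}_1(V)=\mathcal T_1-\mathcal T_2V$ and $\hat{\mathcal T}_2=z^{-N}\mathcal T_2$. Define $$\alpha:=\inf\{\|\hat{\mathcal T}_1(V)-\hat{\mathcal T}_2D\|_\infty : D\in\mathcal{RH}_\infty,\ V\in\mathcal{Y}\}.$$ Then: 1) $\alpha=\inf\{\gamma : \|Y\|_\infty<\gamma \text{ and there exists } V\in\mathcal{Y} \text{ with } \mathrm{dist}(\hat R(V),\mathcal{RH}_\infty)<1\}$; 2) for every $\gamma>\alpha$, every $V\in\mathcal Y$ and all $D,X\in\mathcal{RH}_\infty$ such that $\|\hat R(V)-X\|_\infty\le 1$ and $X=U_oDY_o^{-1}$, one has $\|\hat{\mathcal T}_1(V)-\hat{\mathcal T}_2D\|_\infty\le\gamma$. (Here $Y_o$, $R$ and $\hat R(V)$ depend on $\gamma$.)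
   Context: Discrete time. $\mathcal{RL}_\infty$ is the set of real-rational transfer matrices (of whatever size is required) that are bounded on the unit circle, with norm $\|G\|_\infty=\sup_{|z|=1}\|G(z)\|$ (largest singular value). $\mathcal{RH}_\infty\subset\mathcal{RL}_\infty$ is the set of proper stable ones (all poles in $|z|<1$). $G^\sim(z):=G(z^{-1})^\top$. $\mathrm{dist}(R,\mathcal{RH}_\infty):=\inf\{\|R-X\|_\infty: X\in\mathcal{RH}_\infty\}$. Plant data: $A$ is a real matrix with spectral radius $<1$, $\mathcal{T}_1=C_1(zI-A)^{-1}B_1$ (with $p_1$ columns) and $\mathcal{T}_2=C_1(zI-A)^{-1}B_2+D_{12}$ (with $p_2$ columns), with real matrices such that $D_{12}^\top D_{12}>0$ and $C_1^\top D_{12}=0$. Definitions: - $\mathcal T_2=U_iU_o$ is an inner-outer factorization: $U_i,U_o,U_o^{-1}\in\mathcal{RH}_\infty$, $U_i^\sim U_i=I$. - $Y:=(I-U_iU_i^\sim)\mathcal T_1\in\mathcal{RL}_\infty$. - For $\gamma>\|Y\|_\infty$, $Y_o$ is a bi-stable spectral factor of $\gamma^2I-Y^\sim Y$: $Y_o,Y_o^{-1}\in\mathcal{RH}_\infty$ and $Y_o^\sim Y_o=\gamma^2I-Y^\sim Y$. - $R:=U_i^\sim\mathcal T_1Y_o^{-1}\in\mathcal{RL}_\infty$. - $\mathcal{Y}=\bigoplus_{i=0}^{N-1}z^{-i}\mathcal{Y}_i$, i.e. the set of all $V=\sum_{i=0}^{N-1}z^{-i}V_i$ with $V_i\in\mathcal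 Y_i$, where each $\mathcal{Y}_i\subset\mathbb{R}^{p_2\times p_1}$ is a given linear subspace. - $\hat R(V):=z^NR-U_o\,(z^NV)\,Y_o^{-1}$. *)

theory Defs
  imports
    "HOL-Analysis.Analysis"
    "HOL-Computational_Algebra.Polynomial_Factorial"
    "HOL-Computational_Algebra.Field_as_Ring"
begin

text \<open>
  Scalar transfer functions are elements of the field of rational functions with real
  coefficients; a transfer matrix with \<open>'m\<close> rows and \<open>'p\<close> columns has type
  \<open>ratfun ^ 'p ^ 'm\<close>, so that \<open>**\<close>, \<^const>\<open>transpose\<close>, \<^const>\<open>mat\<close>, \<^const>\<open>invertible\<close> and
  \<^const>\<open>matrix_inv\<close> are the usual operations over that field.
\<close>

type_synonym ratfun = "real poly fract"

definition rf_const :: "real \<Rightarrow> ratfun" where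
  "rf_const c = to_fract [:c:]"

definition rf_z :: ratfun where
  "rf_z = to_fract [:0, 1:]"

text \<open>Numerator and denominator are coprime and the denominator is monic.\<close>

definition rf_num :: "ratfun \<Rightarrow> real poly" where
  "rf_num r = fst (quot_of_fract r)"

definition rf_den :: "ratfun \<Rightarrow> real poly" where
  "rf_den r = snd (quot_of_fract r)"

text \<open>
  Substitution of an element \<open>x\<close> of a field extension of the reals, with embedding \<open>h\<close>, for
  the variable. It is used for evaluation at a complex number and for the substitution
  \<open>z \<mapsto> 1/z\<close>. At a pole, division by zero makes the value \<open>0\<close>.
\<close>

definition rf_subst :: "(real \<Rightarrow> 'b::field) \<Rightarrow> 'b \<Rightarrow> ratfun \<Rightarrow> 'b" where
  "rf_subst h x r = poly (map_poly h (rf_num r)) x / poly (map_poly h (rf_den r)) x"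

definition rf_pole :: "ratfun \<Rightarrow> complex \<Rightarrow> bool" where
  "rf_pole r z \<longleftrightarrow> poly (map_poly complex_of_real (rf_den r)) z = 0"

definition rf_proper :: "ratfun \<Rightarrow> bool" where
  "rf_proper r \<longleftrightarrow> degree (rf_num r) \<le> degree (rf_den r)"

definition tf_const :: "real ^ 'p ^ 'm \<Rightarrow> ratfun ^ 'p ^ 'm" where
  "tf_const M = map_matrix rf_const M"

definition tf_scale :: "ratfun \<Rightarrow> ratfun ^ 'p ^ 'm \<Rightarrow> ratfun ^ 'p ^ 'm" where
  "tf_scale r G = map_matrix (\<lambda>g. r * g) G"

definition tf_eval :: "ratfun ^ 'p ^ 'm \<Rightarrow> complex \<Rightarrow> complex ^ 'p ^ 'm" where
  "tf_eval G z = map_matrix (rf_subst complex_of_real z) G"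

definition para_conj :: "ratfun ^ 'p ^ 'm \<Rightarrow> ratfun ^ 'm ^ 'p" where
  "para_conj G = transpose (map_matrix (rf_subst rf_const (1 / rf_z)) G)"

definition ss_tf ::
  "real ^ 'n ^ 'n \<Rightarrow> real ^ 'p ^ 'n \<Rightarrow> real ^ 'n ^ 'm \<Rightarrow> real ^ 'p ^ 'm \<Rightarrow> ratfun ^ 'p ^ 'm" where
  "ss_tf A B C D = tf_const C ** matrix_inv (mat rf_z - tf_const A) ** tf_const B + tf_const D"

definition eigenvalues :: "complex ^ 'n ^ 'n \<Rightarrow> complex set" where
  "eigenvalues M = {l. \<exists>v. v \<noteq> 0 \<and> M *v v = l *s v}"

definition spectral_radius :: "real ^ 'n ^ 'n \<Rightarrow> real" where
  "spectral_radius A = Max (cmod ` eigenvalues (map_matrix complex_of_real A))"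

text \<open>
  The Gram matrix is of the size of the column space, so for a wide matrix this set
  contains some additional zeros, which do not affect the maximum.
\<close>

definition singular_values :: "complex ^ 'p ^ 'm \<Rightarrow> real set" where
  "singular_values M =
     {s. s \<ge> 0 \<and> complex_of_real (s\<^sup>2) \<in> eigenvalues (map_matrix cnj (transpose M) ** M)}"

definition max_singular_value :: "complex ^ 'p ^ 'm \<Rightarrow> real" where
  "max_singular_value M = Max (singular_values M)"

text \<open>
  A rational matrix with a pole on the unit circle is unbounded near that pole, so it is not in
  \<open>RL_inf\<close> whatever the value assigned at the pole itself.
\<close>

definition RL_inf :: "(ratfun ^ 'p ^ 'm) set" where
  "RL_inf = {G. bounded (tf_eval G ` sphere 0 1)}"

definition hinf_norm :: "ratfun ^ 'p ^ 'm \<Rightarrow> real" where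
  "hinf_norm G = (SUP z\<in>sphere 0 1. max_singular_value (tf_eval G z))"

definition RH_inf :: "(ratfun ^ 'p ^ 'm) set" where
  "RH_inf = {G \<in> RL_inf. \<forall>i j. rf_proper (G $ i $ j) \<and> (\<forall>z. rf_pole (G $ i $ j) z \<longrightarrow> cmod z < 1)}"

definition dist_RH_inf :: "ratfun ^ 'p ^ 'm \<Rightarrow> real" where
  "dist_RH_inf R = Inf {hinf_norm (R - X) | X. X \<in> RH_inf}"

definition inner_outer ::
  "ratfun ^ 'p ^ 'm \<Rightarrow> ratfun ^ 'p ^ 'm \<Rightarrow> ratfun ^ 'p ^ 'p \<Rightarrow> bool" where
  "inner_outer T Ui Uo \<longleftrightarrow>
     T = Ui ** Uo \<and> Ui \<in> RH_inf \<and> Uo \<in> RH_inf \<and> invertible Uo \<and> matrix_inv Uo \<in> RH_inf \<and>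
     para_conj Ui ** Ui = mat 1"

definition bistable_spectral_factor ::
  "ratfun ^ 'p ^ 'p \<Rightarrow> ratfun ^ 'p ^ 'p \<Rightarrow> bool" where
  "bistable_spectral_factor P F \<longleftrightarrow>
     F \<in> RH_inf \<and> invertible F \<and> matrix_inv F \<in> RH_inf \<and> para_conj F ** F = P"

definition delay_space :: "nat \<Rightarrow> (nat \<Rightarrow> (real ^ 'p ^ 'm) set) \<Rightarrow> (ratfun ^ 'p ^ 'm) set" where
  "delay_space N S =
     {(\<Sum>i<N. tf_scale (1 / rf_z ^ i) (tf_const (V i))) | V. \<forall>i<N. V i \<in> S i}"

end

theory Submission
  imports Defs
begin

text \<open>
  Write \<open>Q = V + z\<^sup>-\<^sup>N D\<close>, so that the error to be minimised is \<open>E = T1 - Ui Uo Q\<close>. Because \<open>Ui\<close> has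
  isometric values on the unit circle, \<open>E\<close> splits there into the orthogonal parts \<open>Y\<close>, which no
  choice of \<open>Q\<close> changes, and \<open>Ui W\<close> with \<open>W = Ui\<^sup>~ T1 - Uo Q\<close>. Hence for every vector \<open>x\<close> and every
  \<open>|z| = 1\<close>
  \<open>|E x|\<^sup>2 = |Y x|\<^sup>2 + |W x|\<^sup>2\<close>, while \<open>|Yo x|\<^sup>2 = \<gamma>\<^sup>2 |x|\<^sup>2 - |Y x|\<^sup>2\<close> by the spectral factorization. With
  \<open>X = Uo D Yo\<^sup>-\<^sup>1\<close>, the matrix \<open>K = Rhat V - X\<close> equals \<open>z\<^sup>N W Yo\<^sup>-\<^sup>1\<close>, and adding the two equations gives the identity behind everything
  (lemma \<open>model_matching_identity\<close>):

  \<open>|E x|\<^sup>2 + |Yo x|\<^sup>2 = \<gamma>\<^sup>2 |x|\<^sup>2 + |K (Yo x)|\<^sup>2\<close>.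

  If \<open>K\<close> has norm at most \<open>1\<close>, this says that \<open>E\<close> has norm at most \<open>\<gamma>\<close>. Conversely, if \<open>E\<close> has norm
  \<open>e < \<gamma>\<close>, then \<open>|K (Yo x)|\<^sup>2 \<le> |Yo x|\<^sup>2 - (\<gamma>\<^sup>2 - e\<^sup>2) |x|\<^sup>2\<close>, and since \<open>Yo\<close> is bounded the subtracted
  term is at least a fixed fraction of \<open>|Yo x|\<^sup>2\<close>: the norm of \<open>K\<close> is strictly below \<open>1\<close>. Finally
  \<open>D \<mapsto> Uo D Yo\<^sup>-\<^sup>1\<close> is a bijection of the stable proper matrices, because \<open>Uo\<close> and \<open>Yo\<close> are units
  there, so the existence of some \<open>D\<close> that makes \<open>K\<close> smaller than \<open>1\<close> is the distance condition on
  \<open>Rhat V\<close>. A spectral factor exists for every \<open>\<gamma> > \<alpha>\<close>, since \<open>|E x| \<ge> |Y x|\<close> bounds \<open>\<alpha>\<close> below by the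
  norm of \<open>Y\<close>.

  For these computations with values to be legitimate, two facts of analysis are needed. Membership
  in \<open>RL_inf\<close>, defined by boundedness, means absence of poles on the circle
  (lemma \<open>RL_inf_iff_no_pole\<close>), so that evaluation is compatible with sums, products and
  para-conjugation. And the largest singular value, defined through eigenvalues of the Gram
  matrix, is the operator norm (lemma \<open>max_singular_value_eq_onorm\<close>).
\<close>

section \<open>Values of rational functions\<close>

text \<open>
  Arithmetic of values holds only away from poles, since a pole is given the dummy value \<open>0\<close>.
  Carrying regularity and value together in one relation makes it closed under all operations.
\<close>

definition rf_has_value :: "ratfun \<Rightarrow> complex \<Rightarrow> complex \<Rightarrow> bool" where
  "rf_has_value r z v \<longleftrightarrow> \<not> rf_pole r z \<and> rf_subst complex_of_real z r = v"

abbreviation cpoly :: "real poly \<Rightarrow> complex \<Rightarrow> complex" where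
  "cpoly p \<equiv> poly (map_poly complex_of_real p)"

lemma cpoly_pCons: "cpoly (pCons a p) z = of_real a + z * cpoly p z"
  by (simp add: map_poly_pCons)

lemma cpoly_add: "cpoly (p + q) z = cpoly p z + cpoly q z"
  by (induction p q rule: poly_induct2) (simp_all add: cpoly_pCons algebra_simps)

lemma cpoly_smult: "cpoly (smult a p) z = of_real a * cpoly p z"
  by (simp add: map_poly_smult)

lemma cpoly_mult: "cpoly (p * q) z = cpoly p z * cpoly q z"
  by (induction p) (simp_all add: cpoly_add cpoly_smult cpoly_pCons algebra_simps)

lemma cpoly_1 [simp]: "cpoly 1 z = 1"
  by (simp add: map_poly_1')

lemma cpoly_cnj: "cpoly p (cnj z) = cnj (cpoly p z)"
  by (induction p) (simp_all add: cpoly_pCons)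

lemma rf_den_nonzero [simp]: "rf_den r \<noteq> 0"
  by (simp add: rf_den_def)

lemma rf_eq_num_div_den: "r = to_fract (rf_num r) / to_fract (rf_den r)"
  by (simp add: rf_num_def rf_den_def flip: Fract_conv_to_fract)

lemma coprime_rf_num_rf_den: "coprime (rf_num r) (rf_den r)"
  by (simp add: rf_num_def rf_den_def coprime_quot_of_fract)

lemma rf_fraction_cross_mult:
  assumes "q \<noteq> 0" "r = to_fract p / to_fract q"
  shows "rf_num r * q = p * rf_den r"
proof -
  have "to_fract (rf_num r) / to_fract (rf_den r) = to_fract p / to_fract q"
    using assms(2) rf_eq_num_div_den by metis
  hence "to_fract (rf_num r * q) = to_fract (p * rf_den r)"
    using assms(1) by (simp add: frac_eq_eq)
  thus ?thesis
    by (simp only: to_fract_eq_iff)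
qed

text \<open>
  Any representation whose denominator does not vanish at \<open>z\<close> may be used to compute the value:
  the denominator in lowest terms divides every other one.
\<close>

lemma rf_has_valueI:
  assumes q: "cpoly q z \<noteq> 0" and r: "r = to_fract p / to_fract q"
  shows "rf_has_value r z (cpoly p z / cpoly q z)"
proof -
  have "q \<noteq> 0"
    using q by auto
  hence eq: "rf_num r * q = p * rf_den r"
    using r by (rule rf_fraction_cross_mult)
  hence "rf_den r dvd q"
    using coprime_rf_num_rf_den[of r]
    by (metis coprime_commute coprime_dvd_mult_right_iff dvd_triv_right)
  hence den: "cpoly (rf_den r) z \<noteq> 0"
    using q by (auto simp: dvd_def cpoly_mult)
  have "cpoly (rf_num r) z * cpoly q z = cpoly p z * cpoly (rf_den r) z"
    using eq by (metis cpoly_mult)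
  thus ?thesis
    using q den by (simp add: rf_has_value_def rf_pole_def rf_subst_def frac_eq_eq)
qed

lemma rf_has_valueE:
  assumes "rf_has_value r z v"
  obtains p q where "cpoly q z \<noteq> 0" "q \<noteq> 0" "r = to_fract p / to_fract q" "v = cpoly p z / cpoly q z"
  using assms rf_eq_num_div_den[of r]
  by (metis rf_den_nonzero rf_has_value_def rf_pole_def rf_subst_def)

lemma rf_has_value_add:
  assumes "rf_has_value r z v" "rf_has_value s z w"
  shows "rf_has_value (r + s) z (v + w)"
proof -
  from assms(1) obtain p q where 1: "cpoly q z \<noteq> 0" "q \<noteq> 0" "r = to_fract p / to_fract q" "v = cpoly p z / cpoly q z"
    by (rule rf_has_valueE)
  from assms(2) obtain p' q' where 2: "cpoly q' z \<noteq> 0" "q' \<noteq> 0" "s = to_fract p' / to_fract q'" "w = cpoly p' z / cpoly q' z"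
    by (rule rf_has_valueE)
  have "r + s = to_fract (p * q' + p' * q) / to_fract (q * q')"
    using 1 2 by (simp add: add_frac_eq)
  moreover have "v + w = cpoly (p * q' + p' * q) z / cpoly (q * q') z"
    using 1 2 by (simp add: cpoly_add cpoly_mult add_frac_eq)
  ultimately show ?thesis
    using rf_has_valueI[of "q * q'" z "r + s" "p * q' + p' * q"] 1 2 by (simp only: cpoly_mult) simp
qed

lemma rf_has_value_mult:
  assumes "rf_has_value r z v" "rf_has_value s z w"
  shows "rf_has_value (r * s) z (v * w)"
proof -
  from assms(1) obtain p q where 1: "cpoly q z \<noteq> 0" "q \<noteq> 0" "r = to_fract p / to_fract q" "v = cpoly p z / cpoly q z"
    by (rule rf_has_valueE)
  from assms(2) obtain p' q' where 2: "cpoly q' z \<noteq> 0" "q' \<noteq> 0" "s = to_fract p' / to_fract q'" "w = cpoly p' z / cpoly q' z"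
    by (rule rf_has_valueE)
  show ?thesis
    using rf_has_valueI[of "q * q'" z "r * s" "p * p'"] 1 2 by (simp add: cpoly_mult)
qed

lemma rf_has_value_inverse:
  assumes "rf_has_value r z v" "v \<noteq> 0"
  shows "rf_has_value (inverse r) z (inverse v)"
proof -
  from assms(1) obtain p q where 1: "cpoly q z \<noteq> 0" "q \<noteq> 0" "r = to_fract p / to_fract q" "v = cpoly p z / cpoly q z"
    by (rule rf_has_valueE)
  with assms(2) rf_has_valueI[of p z "inverse r" q] show ?thesis
    by auto
qed

lemma rf_has_value_divide:
  assumes "rf_has_value r z v" "rf_has_value s z w" "w \<noteq> 0"
  shows "rf_has_value (r / s) z (v / w)"
  using rf_has_value_mult[OF assms(1) rf_has_value_inverse[OF assms(2,3)]]
  by (simp add: divide_inverse)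

lemma rf_has_value_const: "rf_has_value (rf_const c) z (of_real c)"
  using rf_has_valueI[of 1 z "rf_const c" "[:c:]"]
  by (simp add: rf_const_def cpoly_pCons)

lemma rf_has_value_z: "rf_has_value rf_z z z"
  using rf_has_valueI[of 1 z rf_z "[:0, 1:]"]
  by (simp add: rf_z_def cpoly_pCons)

lemma rf_const_0 [simp]: "rf_const 0 = 0" and rf_const_1 [simp]: "rf_const 1 = 1"
  by (simp_all add: rf_const_def flip: one_pCons)

lemma rf_has_value_0: "rf_has_value 0 z 0" and rf_has_value_1: "rf_has_value 1 z 1"
  using rf_has_value_const[of 0 z] rf_has_value_const[of 1 z] by simp_all

lemma rf_has_value_uminus:
  assumes "rf_has_value r z v"
  shows "rf_has_value (- r) z (- v)"
proof -
  have "[:- 1:] = - (1 :: real poly)"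
    by (simp add: one_pCons)
  hence "rf_const (- 1) * r = - r"
    unfolding rf_const_def by (simp only: to_fract_uminus to_fract_1 mult_minus1)
  thus ?thesis
    using rf_has_value_mult[OF rf_has_value_const[of "- 1"] assms] by simp
qed

lemma rf_has_value_diff:
  "rf_has_value r z v \<Longrightarrow> rf_has_value s z w \<Longrightarrow> rf_has_value (r - s) z (v - w)"
  using rf_has_value_add[OF _ rf_has_value_uminus] by force

lemma rf_has_value_sum:
  assumes "\<And>i. i \<in> I \<Longrightarrow> rf_has_value (r i) z (v i)"
  shows "rf_has_value (\<Sum>i\<in>I. r i) z (\<Sum>i\<in>I. v i)"
  using assms by (induction I rule: infinite_finite_induct) (auto intro: rf_has_value_0 rf_has_value_add)

lemma rf_has_value_prod:
  assumes "\<And>i. i \<in> I \<Longrightarrow> rf_has_value (r i) z (v i)"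
  shows "rf_has_value (\<Prod>i\<in>I. r i) z (\<Prod>i\<in>I. v i)"
  using assms by (induction I rule: infinite_finite_induct) (auto intro: rf_has_value_1 rf_has_value_mult)

lemma rf_has_value_power: "rf_has_value r z v \<Longrightarrow> rf_has_value (r ^ n) z (v ^ n)"
  by (induction n) (auto intro: rf_has_value_1 rf_has_value_mult)

lemma rf_has_value_unique: "rf_has_value r z v \<Longrightarrow> rf_has_value r z w \<Longrightarrow> v = w"
  by (simp add: rf_has_value_def)

text \<open>
  On the unit circle \<open>1/z\<close> is the conjugate of \<open>z\<close>, and real coefficients commute with conjugation.
\<close>

lemma rf_has_value_reflect:
  assumes r: "rf_has_value r z v" and z: "cmod z = 1"
  shows "rf_has_value (rf_subst rf_const (1 / rf_z) r) z (cnj v)"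
proof -
  have "1 / z = cnj z"
    using z by (metis complex_div_cnj div_by_1 mult_1 of_real_1 power_one)
  hence inv: "rf_has_value (1 / rf_z) z (cnj z)"
    using rf_has_value_divide[OF rf_has_value_1 rf_has_value_z, of z] z by force
  have eval: "rf_has_value (poly (map_poly rf_const p) (1 / rf_z)) z (cpoly p (cnj z))" for p
  proof (induction p)
    case 0
    show ?case
      by (simp add: rf_has_value_0)
  next
    case (pCons a p)
    from rf_has_value_add[OF rf_has_value_const rf_has_value_mult[OF inv pCons.IH]] show ?case
      by (simp only: map_poly_pCons[of rf_const, OF rf_const_0] cpoly_pCons poly_pCons)
  qed
  have v: "cnj v = cpoly (rf_num r) (cnj z) / cpoly (rf_den r) (cnj z)" "cpoly (rf_den r) (cnj z) \<noteq> 0"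
    using r by (auto simp: rf_has_value_def rf_pole_def rf_subst_def cpoly_cnj)
  show ?thesis
    unfolding rf_subst_def v(1) by (rule rf_has_value_divide[OF eval eval v(2)])
qed

section \<open>Values of rational matrices\<close>

definition tf_has_value :: "ratfun ^ 'p ^ 'm \<Rightarrow> complex \<Rightarrow> complex ^ 'p ^ 'm \<Rightarrow> bool" where
  "tf_has_value G z M \<longleftrightarrow> (\<forall>i j. rf_has_value (G $ i $ j) z (M $ i $ j))"

definition adjoint_mat :: "complex ^ 'p ^ 'm \<Rightarrow> complex ^ 'm ^ 'p" where
  "adjoint_mat M = map_matrix cnj (transpose M)"

lemma tf_has_value_eval: "tf_has_value G z M \<Longrightarrow> tf_eval G z = M"
  by (simp add: tf_has_value_def rf_has_value_def tf_eval_def vec_eq_iff)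

lemma tf_has_value_mult:
  "tf_has_value G z M \<Longrightarrow> tf_has_value H z K \<Longrightarrow> tf_has_value (G ** H) z (M ** K)"
  by (auto simp: tf_has_value_def matrix_matrix_mult_def intro!: rf_has_value_sum rf_has_value_mult)

lemma tf_has_value_add:
  "tf_has_value G z M \<Longrightarrow> tf_has_value H z K \<Longrightarrow> tf_has_value (G + H) z (M + K)"
  by (auto simp: tf_has_value_def intro!: rf_has_value_add)

lemma tf_has_value_diff:
  "tf_has_value G z M \<Longrightarrow> tf_has_value H z K \<Longrightarrow> tf_has_value (G - H) z (M - K)"
  by (auto simp: tf_has_value_def intro!: rf_has_value_diff)

lemma tf_has_value_scale:
  "rf_has_value r z c \<Longrightarrow> tf_has_value G z M \<Longrightarrow> tf_has_value (tf_scale r G) z (map_matrix (\<lambda>g. c * g) M)"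
  by (auto simp: tf_has_value_def tf_scale_def intro!: rf_has_value_mult)

lemma tf_has_value_mat: "rf_has_value r z c \<Longrightarrow> tf_has_value (mat r) z (mat c)"
  by (auto simp: tf_has_value_def mat_def intro: rf_has_value_0)

lemma tf_has_value_const: "tf_has_value (tf_const M) z (map_matrix complex_of_real M)"
  by (auto simp: tf_has_value_def tf_const_def intro: rf_has_value_const)

lemma tf_has_value_para_conj:
  "tf_has_value G z M \<Longrightarrow> cmod z = 1 \<Longrightarrow> tf_has_value (para_conj G) z (adjoint_mat M)"
  by (auto simp: tf_has_value_def para_conj_def adjoint_mat_def transpose_def intro: rf_has_value_reflect)

lemma rf_has_value_det:
  "tf_has_value G z M \<Longrightarrow> rf_has_value (det G) z (det M)"
proof -
  assume *: "tf_has_value G z M"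
  have sgn: "rf_has_value (of_int (sign p)) z (of_int (sign p))" for p :: "'a \<Rightarrow> 'a"
    using rf_has_value_uminus[OF rf_has_value_1] by (auto simp: sign_def intro: rf_has_value_1)
  show ?thesis
    unfolding det_def using *
    by (auto simp: tf_has_value_def intro!: rf_has_value_sum rf_has_value_mult rf_has_value_prod sgn)
qed

lemma matrix_inv_right:
  fixes G :: "'a::field ^ 'n ^ 'n"
  shows "invertible G \<Longrightarrow> G ** matrix_inv G = mat 1"
  unfolding matrix_inv_def invertible_def by (metis (mono_tags, lifting) someI_ex)

lemma matrix_inv_left:
  fixes G :: "'a::field ^ 'n ^ 'n"
  shows "invertible G \<Longrightarrow> matrix_inv G ** G = mat 1"
  unfolding matrix_inv_def invertible_def by (metis (mono_tags, lifting) someI_ex)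

lemma matrix_inv_cramer:
  fixes G :: "'a::field ^ 'n ^ 'n"
  assumes "det G \<noteq> 0"
  shows "matrix_inv G $ k $ l = det (\<chi> i j. if j = k then mat 1 $ i $ l else G $ i $ j) / det G"
proof -
  have "G ** matrix_inv G = mat 1"
    using assms by (simp add: matrix_inv_right invertible_det_nz)
  hence "G *v column l (matrix_inv G) = column l (mat 1)"
    by (simp add: vec_eq_iff matrix_vector_mult_def matrix_matrix_mult_def column_def)
  hence "column l (matrix_inv G) =
      (\<chi> k. det (\<chi> i j. if j = k then column l (mat 1) $ i else G $ i $ j) / det G)"
    by (simp add: cramer[OF assms])
  hence "column l (matrix_inv G) $ k =
      (\<chi> k. det (\<chi> i j. if j = k then column l (mat 1) $ i else G $ i $ j) / det G) $ k"
    by (rule arg_cong)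
  thus ?thesis
    by (simp add: column_def cong: if_cong)
qed

text \<open>
  By Cramer's rule the entries of the inverse are determinants divided by \<open>det G\<close>, so the inverse
  is regular wherever \<open>det G\<close> has a non-zero value.
\<close>

lemma tf_has_value_matrix_inv:
  assumes G: "tf_has_value G z M" and M: "det M \<noteq> 0"
  shows "tf_has_value (matrix_inv G) z (matrix_inv M)"
proof -
  have det: "rf_has_value (det G) z (det M)"
    using G by (rule rf_has_value_det)
  with M have "det G \<noteq> 0"
    using rf_has_value_0 rf_has_value_unique by metis
  moreover have "tf_has_value (\<chi> i j. if j = k then mat 1 $ i $ l else G $ i $ j) z
      (\<chi> i j. if j = k then mat 1 $ i $ l else M $ i $ j)" for k l
    using G tf_has_value_mat[OF rf_has_value_1[of z]] unfolding tf_has_value_def by auto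
  ultimately show ?thesis
    using det M unfolding tf_has_value_def
    by (auto simp: matrix_inv_cramer intro!: rf_has_value_divide rf_has_value_det simp: tf_has_value_def)
qed

section \<open>Singular values and the operator norm\<close>

lemma of_real_vector_scale: "complex_of_real c *s v = c *\<^sub>R v"
  by (simp add: vec_eq_iff) (simp add: scaleR_conv_of_real)

text \<open>
  The real inner product of complex vectors is the real part of the Hermitian one, so the conjugate
  transpose is also the adjoint in the real sense, and complex scalars can be avoided below.
\<close>

lemma inner_adjoint_mat: "(M *v x) \<bullet> y = x \<bullet> (adjoint_mat M *v y)"
proof -
  have c: "(a * b) \<bullet> d = b \<bullet> (cnj a * d)" for a b d :: complex
    by (simp add: inner_complex_def algebra_simps)
  have "(M *v x) \<bullet> y = (\<Sum>i\<in>UNIV. \<Sum>j\<in>UNIV. x $ j \<bullet> (cnj (M $ i $ j) * y $ i))"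
    by (simp add: inner_vec_def matrix_vector_mult_def inner_sum_left c)
  also have "\<dots> = x \<bullet> (adjoint_mat M *v y)"
    by (subst sum.swap)
      (simp add: inner_vec_def matrix_vector_mult_def inner_sum_right adjoint_mat_def transpose_def)
  finally show ?thesis .
qed

lemma bounded_linear_matrix_vector_mul: "bounded_linear ((*v) (M :: complex ^ 'p ^ 'm))"
  using matrix_vector_mul_linear[of M] by (simp add: linear_conv_bounded_linear)

lemma mat_vector_mul: "mat l *v v = l *s (v :: complex ^ 'n)"
  by (simp add: vec_eq_iff matrix_vector_mult_def mat_def if_distrib if_distribR cong: if_cong)

lemma eigenvalue_iff_det: "l \<in> eigenvalues M \<longleftrightarrow> det (mat l - M) = 0"
proof -
  have "det (mat l - M) \<noteq> 0 \<longleftrightarrow> (\<forall>v. (mat l - M) *v v = 0 \<longrightarrow> v = 0)"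
    by (simp only: invertible_det_nz[symmetric] invertible_left_inverse matrix_left_invertible_ker)
  thus ?thesis
    by (auto simp: eigenvalues_def matrix_vector_mult_diff_rdistrib mat_vector_mul)
qed

text \<open>
  The eigenvalues are the roots of the characteristic polynomial, which is not zero because no
  real number larger than the operator norm is an eigenvalue. Finiteness matters since \<^const>\<open>Max\<close> says
  nothing about infinite sets.
\<close>

lemma finite_eigenvalues: "finite (eigenvalues (M :: complex ^ 'n ^ 'n))"
proof -
  define P :: "complex poly ^ 'n ^ 'n" where
    "P = (\<chi> i j. [:- (M $ i $ j), if i = j then 1 else 0:])"
  have "poly (det P) l = det (mat l - M)" for l
    unfolding det_def P_def
    by (auto simp: poly_sum poly_prod mat_def sign_def intro!: sum.cong prod.cong)
  hence eig: "eigenvalues M = {l. poly (det P) l = 0}"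
    by (auto simp: eigenvalue_iff_det)
  have "complex_of_real (onorm ((*v) M) + 1) \<notin> eigenvalues M"
  proof
    assume "complex_of_real (onorm ((*v) M) + 1) \<in> eigenvalues M"
    then obtain v where v: "v \<noteq> 0" "M *v v = (onorm ((*v) M) + 1) *\<^sub>R v"
      unfolding eigenvalues_def mem_Collect_eq of_real_vector_scale by blast
    have "norm (M *v v) \<le> onorm ((*v) M) * norm v"
      by (rule onorm) (rule bounded_linear_matrix_vector_mul)
    moreover have "norm (M *v v) = (onorm ((*v) M) + 1) * norm v"
      using onorm_pos_le[OF bounded_linear_matrix_vector_mul[of M]] v by simp
    ultimately show False
      using v(1) by (simp add: algebra_simps)
  qed
  hence "det P \<noteq> 0"
    by (auto simp: eig)
  thus ?thesis
    unfolding eig by (rule poly_roots_finite)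
qed

text \<open>
  The quadratic form \<open>c\<^sup>2 |w|\<^sup>2 - |M w|\<^sup>2\<close> with \<open>c = |M v|\<close> is nonnegative and vanishes at \<open>v\<close>, so \<open>v\<close>
  lies in its kernel: a small step from \<open>v\<close> against the gradient \<open>u\<close> would make the form negative if
  \<open>u\<close> were not zero.
\<close>

lemma norm_maximizer_is_eigenvector:
  assumes max: "\<And>w. norm (M *v w) \<le> norm (M *v v) * norm w" and v: "norm v = 1"
  shows "adjoint_mat M *v (M *v v) = (norm (M *v v))\<^sup>2 *\<^sub>R v"
proof (rule ccontr)
  define c where "c = norm (M *v v)"
  define u where "u = c\<^sup>2 *\<^sub>R v - adjoint_mat M *v (M *v v)"
  define K where "K = c\<^sup>2 * (norm u)\<^sup>2 - (norm (M *v u))\<^sup>2"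
  assume "\<not> ?thesis"
  hence u: "(norm u)\<^sup>2 > 0"
    by (auto simp: u_def c_def)
  interpret bounded_linear "(*v) M"
    by (rule bounded_linear_matrix_vector_mul)
  have defect: "(norm (M *v w))\<^sup>2 \<le> c\<^sup>2 * (norm w)\<^sup>2" for w
    using max[of w] unfolding c_def by (metis norm_ge_zero power_mono power_mult_distrib)
  have K: "K \<ge> 0"
    using defect[of u] by (simp add: K_def)
  have first_order: "c\<^sup>2 * (v \<bullet> u) - (M *v v) \<bullet> (M *v u) = (norm u)\<^sup>2"
  proof -
    have "(M *v v) \<bullet> (M *v u) = u \<bullet> (adjoint_mat M *v (M *v v))"
      by (metis inner_adjoint_mat inner_commute)
    moreover have "u \<bullet> u = (c\<^sup>2 *\<^sub>R v) \<bullet> u - (adjoint_mat M *v (M *v v)) \<bullet> u"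
      by (metis u_def inner_diff_left)
    ultimately have "c\<^sup>2 * (v \<bullet> u) - (M *v v) \<bullet> (M *v u) = u \<bullet> u"
      by (simp add: inner_commute)
    thus ?thesis
      by (simp add: power2_norm_eq_inner)
  qed
  \<comment> \<open>A step so short that the quadratic term \<open>t\<^sup>2 K\<close> cannot compensate the linear term \<open>2 t |u|\<^sup>2\<close>.\<close>
  define t where "t = (norm u)\<^sup>2 / (K + 1)"
  have "0 \<le> c\<^sup>2 * (norm (v - t *\<^sub>R u))\<^sup>2 - (norm (M *v (v - t *\<^sub>R u)))\<^sup>2"
    using defect[of "v - t *\<^sub>R u"] by simp
  also have "\<dots> = (c\<^sup>2 * (norm v)\<^sup>2 - (norm (M *v v))\<^sup>2)
      - 2 * t * (c\<^sup>2 * (v \<bullet> u) - (M *v v) \<bullet> (M *v u)) + t\<^sup>2 * K"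
    unfolding K_def diff scaleR power2_norm_eq_inner
    by (simp add: inner_diff_left inner_diff_right inner_commute power2_eq_square algebra_simps)
  also have "\<dots> = t * (t * K - 2 * (norm u)\<^sup>2)"
    unfolding first_order using v by (simp add: c_def power2_eq_square algebra_simps)
  also have "\<dots> < 0"
  proof -
    have "t > 0"
      using u K by (simp add: t_def)
    moreover have "t * K \<le> (norm u)\<^sup>2"
      using u K by (simp add: t_def field_simps)
    hence "t * K - 2 * (norm u)\<^sup>2 < 0"
      using u by linarith
    ultimately show ?thesis
      by (rule mult_pos_neg)
  qed
  finally show False
    by simp
qed

lemma singular_values_iff:
  "s \<in> singular_values M \<longleftrightarrow>
     s \<ge> 0 \<and> (\<exists>v. v \<noteq> 0 \<and> adjoint_mat M *v (M *v v) = s\<^sup>2 *\<^sub>R v)"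
  unfolding singular_values_def eigenvalues_def adjoint_mat_def
  by (simp only: mem_Collect_eq of_real_vector_scale matrix_vector_mul_assoc)

text \<open>
  A unit vector at which \<open>|M v|\<close> is maximal exists by compactness, and it exhibits the operator norm
  as a singular value. No singular value is larger, because \<open>M\<close> stretches the corresponding
  eigenvector by exactly that factor.
\<close>

lemma max_singular_value_eq_onorm: "max_singular_value M = onorm ((*v) M)"
proof -
  note lin = bounded_linear_matrix_vector_mul[of M]
  have "continuous_on (sphere 0 1) (\<lambda>v. norm (M *v v))"
    by (intro continuous_intros linear_continuous_on lin)
  moreover obtain e :: "complex ^ 'a" where "norm e = 1"
    using vector_choose_size[of 1] by auto
  hence "sphere (0 :: complex ^ 'a) 1 \<noteq> {}"
    by auto
  ultimately obtain v where v: "norm v = 1" and sup: "\<And>w. norm w = 1 \<Longrightarrow> norm (M *v w) \<le> norm (M *v v)"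
    using continuous_attains_sup[of "sphere 0 1"] by (metis compact_sphere mem_sphere_0)
  have max: "norm (M *v w) \<le> norm (M *v v) * norm w" for w
  proof (cases "w = 0")
    case False
    have "M *v (inverse (norm w) *\<^sub>R w) = inverse (norm w) *\<^sub>R (M *v w)"
      using lin by (simp add: linear_cmul bounded_linear.linear)
    thus ?thesis
      using sup[of "inverse (norm w) *\<^sub>R w"] False by (simp add: field_simps)
  qed simp
  have onorm: "onorm ((*v) M) = norm (M *v v)"
  proof (rule antisym)
    show "onorm ((*v) M) \<le> norm (M *v v)"
      using max by (rule onorm_le)
    show "norm (M *v v) \<le> onorm ((*v) M)"
      using onorm[OF lin, of v] v by simp
  qed
  show ?thesis
    unfolding max_singular_value_def onorm
  proof (rule Max_eqI)
    have "inj_on (\<lambda>s. complex_of_real (s\<^sup>2)) (singular_values M)"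
      by (auto simp: inj_on_def singular_values_def power2_eq_iff_nonneg simp flip: of_real_power)
    moreover have "finite ((\<lambda>s. complex_of_real (s\<^sup>2)) ` singular_values M)"
      by (rule finite_subset[OF _ finite_eigenvalues[of "map_matrix cnj (transpose M) ** M"]])
        (auto simp: singular_values_def)
    ultimately show "finite (singular_values M)"
      by (rule finite_imageD[rotated])
    show "norm (M *v v) \<in> singular_values M"
      using norm_maximizer_is_eigenvector[OF max v] v unfolding singular_values_iff
      by (metis norm_ge_zero norm_zero zero_neq_one)
  next
    fix s assume "s \<in> singular_values M"
    then obtain w where s: "s \<ge> 0" and w: "w \<noteq> 0" "adjoint_mat M *v (M *v w) = s\<^sup>2 *\<^sub>R w"
      by (auto simp: singular_values_iff)
    have "(norm (M *v w))\<^sup>2 = (s * norm w)\<^sup>2"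
      unfolding power2_norm_eq_inner inner_adjoint_mat w(2)
      by (simp add: power_mult_distrib power2_norm_eq_inner)
    hence "norm (M *v w) = s * norm w"
      using s by (simp add: power2_eq_iff_nonneg)
    thus "s \<le> norm (M *v v)"
      using max[of w] w(1) by simp
  qed
qed

section \<open>The Hardy and Lebesgue spaces of rational matrices\<close>

text \<open>
  With numerator \<open>n\<close>, denominator \<open>d\<close> and a bound \<open>B\<close>, the inequality \<open>|n| \<le> B |d|\<close> holds on the
  circle outside the finitely many zeros of \<open>d\<close>. By continuity it extends to these zeros, where it
  would make \<open>n\<close> vanish together with \<open>d\<close>, against coprimality.
\<close>

lemma RL_inf_imp_no_pole:
  assumes G: "G \<in> RL_inf" and z0: "cmod z0 = 1"
  shows "\<not> rf_pole (G $ i $ j) z0"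
proof
  define n d where "n = cpoly (rf_num (G $ i $ j))" and "d = cpoly (rf_den (G $ i $ j))"
  assume "rf_pole (G $ i $ j) z0"
  hence d0: "d z0 = 0"
    by (simp add: rf_pole_def d_def)
  \<comment> \<open>The Bezout identity of the coprime real polynomials excludes a common complex zero.\<close>
  obtain a b where "a * rf_num (G $ i $ j) + b * rf_den (G $ i $ j) = 1"
    using bezout_coefficients_fst_snd[of "rf_num (G $ i $ j)" "rf_den (G $ i $ j)"]
      coprime_rf_num_rf_den[of "G $ i $ j"] by (simp add: coprime_iff_gcd_eq_1)
  hence "cpoly (a * rf_num (G $ i $ j) + b * rf_den (G $ i $ j)) z0 = cpoly 1 z0"
    by (rule arg_cong)
  hence "cpoly a z0 * n z0 + cpoly b z0 * d z0 = 1"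
    unfolding n_def d_def by (simp only: cpoly_1 cpoly_add cpoly_mult)
  hence n0: "n z0 \<noteq> 0"
    using d0 by auto
  obtain B where "\<forall>M\<in>tf_eval G ` sphere 0 1. norm M \<le> B"
    using G by (auto simp: RL_inf_def bounded_iff)
  hence B: "norm (tf_eval G z) \<le> B" if "cmod z = 1" for z
    using that by auto
  have bound: "cmod (n z) \<le> B * cmod (d z)" if "cmod z = 1" "d z \<noteq> 0" for z
  proof -
    have "cmod (n z / d z) = cmod (tf_eval G z $ i $ j)"
      by (simp add: tf_eval_def rf_subst_def n_def d_def)
    also have "\<dots> \<le> B"
      by (rule order_trans[OF Finite_Cartesian_Product.norm_nth_le
            order_trans[OF Finite_Cartesian_Product.norm_nth_le B[OF that(1)]]])
    finally show ?thesis
      using that(2) by (simp add: norm_divide field_simps)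
  qed
  have "finite {z. d z = 0}"
    unfolding d_def by (rule poly_roots_finite) (simp add: map_poly_eq_0_iff)
  moreover have "z0 islimpt sphere 0 1"
  proof (rule connected_imp_perfect)
    fix x
    have "1 \<in> sphere (0 :: complex) 1" "- 1 \<in> sphere (0 :: complex) 1"
      by simp_all
    moreover have "1 \<noteq> (- 1 :: complex)"
      by simp
    ultimately show "sphere (0 :: complex) 1 \<noteq> {x}"
      by (metis singletonD)
  qed (use z0 in \<open>auto intro: connected_sphere\<close>)
  hence "z0 islimpt {z. d z = 0} \<union> (sphere 0 1 - {z. d z = 0})"
    by (rule islimpt_subset) auto
  ultimately have "z0 islimpt (sphere 0 1 - {z. d z = 0})"
    by (simp only: islimpt_Un_finite)
  hence "z0 \<in> closure (sphere 0 1 - {z. d z = 0})"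
    by (simp add: closure_def)
  moreover have "closed {z. cmod (n z) \<le> B * cmod (d z)}"
    unfolding n_def d_def by (intro closed_Collect_le continuous_intros)
  hence "closure (sphere 0 1 - {z. d z = 0}) \<subseteq> {z. cmod (n z) \<le> B * cmod (d z)}"
    using bound by (intro closure_minimal) auto
  ultimately show False
    using n0 d0 by auto
qed

lemma RL_inf_iff_no_pole:
  "G \<in> RL_inf \<longleftrightarrow> (\<forall>z i j. cmod z = 1 \<longrightarrow> \<not> rf_pole (G $ i $ j) z)"
proof (intro iffI allI impI)
  fix z i j
  assume "G \<in> RL_inf" "cmod z = 1"
  thus "\<not> rf_pole (G $ i $ j) z"
    by (rule RL_inf_imp_no_pole)
next
  assume *: "\<forall>z i j. cmod z = 1 \<longrightarrow> \<not> rf_pole (G $ i $ j) z"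
  have "continuous_on (sphere 0 1) (\<lambda>z. tf_eval G z)"
    unfolding tf_eval_def map_matrix_def rf_subst_def
    using * by (intro continuous_on_vec_lambda continuous_intros) (auto simp: rf_pole_def)
  hence "compact (tf_eval G ` sphere 0 1)"
    by (intro compact_continuous_image) auto
  thus "G \<in> RL_inf"
    by (simp add: RL_inf_def compact_imp_bounded)
qed

lemma RL_infI:
  assumes "\<And>z. cmod z = 1 \<Longrightarrow> \<exists>M. tf_has_value G z M"
  shows "G \<in> RL_inf"
  unfolding RL_inf_iff_no_pole using assms by (auto simp: tf_has_value_def rf_has_value_def)

lemma RL_inf_has_value:
  assumes "G \<in> RL_inf" "cmod z = 1"
  shows "tf_has_value G z (tf_eval G z)"
  using assms by (auto simp: RL_inf_iff_no_pole tf_has_value_def rf_has_value_def tf_eval_def)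

lemma RL_inf_mult: "G \<in> RL_inf \<Longrightarrow> H \<in> RL_inf \<Longrightarrow> G ** H \<in> RL_inf"
  by (meson RL_infI RL_inf_has_value tf_has_value_mult)

lemma RL_inf_diff: "G \<in> RL_inf \<Longrightarrow> H \<in> RL_inf \<Longrightarrow> G - H \<in> RL_inf"
  by (meson RL_infI RL_inf_has_value tf_has_value_diff)

lemma RL_inf_mat_1: "mat 1 \<in> RL_inf"
  by (meson RL_infI rf_has_value_1 tf_has_value_mat)

lemma RL_inf_para_conj: "G \<in> RL_inf \<Longrightarrow> para_conj G \<in> RL_inf"
  by (meson RL_infI RL_inf_has_value tf_has_value_para_conj)

lemma rf_has_value_inverse_delay:
  assumes "cmod z = 1"
  shows "rf_has_value (1 / rf_z ^ k) z (inverse (z ^ k))"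
  using rf_has_value_inverse[OF rf_has_value_power[OF rf_has_value_z], of z k] assms
  by (force simp: divide_inverse)

lemma RL_inf_advance: "G \<in> RL_inf \<Longrightarrow> tf_scale (rf_z ^ k) G \<in> RL_inf"
  by (meson RL_infI RL_inf_has_value rf_has_value_power rf_has_value_z tf_has_value_scale)

lemma RL_inf_delay: "G \<in> RL_inf \<Longrightarrow> tf_scale (1 / rf_z ^ k) G \<in> RL_inf"
  by (meson RL_infI RL_inf_has_value rf_has_value_inverse_delay tf_has_value_scale)

lemma delay_space_subset_RL_inf: "delay_space N S \<subseteq> RL_inf"
proof (intro subsetI RL_infI)
  fix G z assume "G \<in> delay_space N S" and z: "cmod z = 1"
  then obtain V where G: "G = (\<Sum>i<N. tf_scale (1 / rf_z ^ i) (tf_const (V i)))"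
    by (auto simp: delay_space_def)
  have "tf_has_value G z (\<Sum>i<N. map_matrix (\<lambda>g. inverse (z ^ i) * g) (map_matrix complex_of_real (V i)))"
    unfolding G tf_has_value_def
    using tf_has_value_scale[OF rf_has_value_inverse_delay[OF z] tf_has_value_const]
    by (auto simp: tf_has_value_def intro!: rf_has_value_sum)
  thus "\<exists>M. tf_has_value G z M" ..
qed

text \<open>
  A number of modulus \<open>1\<close> exceeds the spectral radius, hence is not an eigenvalue, and \<open>zI - A\<close> is
  invertible there.
\<close>

lemma ss_tf_in_RL_inf:
  assumes "spectral_radius A < 1"
  shows "ss_tf A B C D \<in> RL_inf"
proof (rule RL_infI)
  fix z :: complex assume z: "cmod z = 1"
  define AC where "AC = map_matrix complex_of_real A"
  have "z \<notin> eigenvalues AC"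
  proof
    assume "z \<in> eigenvalues AC"
    hence "cmod z \<le> spectral_radius A"
      unfolding spectral_radius_def AC_def[symmetric]
      by (intro Max_ge finite_imageI finite_eigenvalues imageI)
    thus False
      using z assms by simp
  qed
  hence "det (mat z - AC) \<noteq> 0"
    by (simp add: eigenvalue_iff_det)
  hence "tf_has_value (matrix_inv (mat rf_z - tf_const A)) z (matrix_inv (mat z - AC))"
    unfolding AC_def
    by (intro tf_has_value_matrix_inv tf_has_value_diff tf_has_value_mat rf_has_value_z tf_has_value_const)
  thus "\<exists>M. tf_has_value (ss_tf A B C D) z M"
    unfolding ss_tf_def by (blast intro: tf_has_value_add tf_has_value_mult tf_has_value_const)
qed

text \<open>
  Without this bound the supremum in \<^const>\<open>hinf_norm\<close> would be an unspecified real number.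
\<close>

lemma max_singular_value_bdd_above:
  fixes G :: "ratfun ^ 'p ^ 'm"
  assumes "G \<in> RL_inf"
  shows "bdd_above ((\<lambda>z. max_singular_value (tf_eval G z)) ` sphere 0 1)"
proof -
  have "bilinear ((*v) :: complex ^ 'p ^ 'm \<Rightarrow> complex ^ 'p \<Rightarrow> complex ^ 'm)"
    unfolding bilinear_def
    by (auto intro!: linearI simp: algebra_simps) 
       (auto simp: vec_eq_iff matrix_vector_mult_def scaleR_sum_right)
  then obtain K where K: "K > 0" "\<And>M x. norm ((M :: complex ^ 'p ^ 'm) *v x) \<le> norm M * norm x * K"
    unfolding bilinear_conv_bounded_bilinear using bounded_bilinear.pos_bounded by blast
  obtain B where "\<forall>M\<in>tf_eval G ` sphere 0 1. norm M \<le> B"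
    using assms by (auto simp: RL_inf_def bounded_iff)
  hence B: "norm (tf_eval G z) \<le> B" if "cmod z = 1" for z
    using that by auto
  have "max_singular_value (tf_eval G z) \<le> B * K" if "cmod z = 1" for z
    unfolding max_singular_value_eq_onorm
  proof (rule onorm_le)
    fix x :: "complex ^ 'p"
    have "norm (tf_eval G z) * (norm x * K) \<le> B * (norm x * K)"
      using B[OF that] K(1) by (intro mult_right_mono) auto
    thus "norm (tf_eval G z *v x) \<le> B * K * norm x"
      using K(2)[of "tf_eval G z" x] by (simp add: mult_ac)
  qed
  thus ?thesis
    by (auto intro!: bdd_aboveI2)
qed

lemma norm_le_hinf_norm:
  assumes "G \<in> RL_inf" "cmod z = 1"
  shows "norm (tf_eval G z *v x) \<le> hinf_norm G * norm x"
proof -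
  have "onorm ((*v) (tf_eval G z)) \<le> hinf_norm G"
    unfolding hinf_norm_def max_singular_value_eq_onorm[symmetric]
    by (rule cSUP_upper[OF _ max_singular_value_bdd_above[OF assms(1)]]) (use assms(2) in auto)
  hence "onorm ((*v) (tf_eval G z)) * norm x \<le> hinf_norm G * norm x"
    by (intro mult_right_mono) auto
  thus ?thesis
    by (rule order_trans[OF onorm[OF bounded_linear_matrix_vector_mul]])
qed

lemma hinf_norm_le:
  assumes "\<And>z x. cmod z = 1 \<Longrightarrow> norm (tf_eval G z *v x) \<le> c * norm x"
  shows "hinf_norm G \<le> c"
  unfolding hinf_norm_def max_singular_value_eq_onorm
proof (rule cSUP_least)
  have "(1 :: complex) \<in> sphere 0 1"
    by simp
  thus "sphere (0 :: complex) 1 \<noteq> {}"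
    by blast
qed (auto intro!: onorm_le assms)

lemma hinf_norm_nonneg:
  assumes "G \<in> RL_inf"
  shows "0 \<le> hinf_norm G"
proof -
  obtain x :: "complex ^ 'a" where "norm x = 1"
    using vector_choose_size[of 1] by auto
  thus ?thesis
    using order_trans[OF norm_ge_zero norm_le_hinf_norm[OF assms, of 1 x]] by simp
qed

lemma RH_inf_subset_RL_inf: "RH_inf \<subseteq> RL_inf"
  by (auto simp: RH_inf_def)

lemma rf_proper_fraction:
  assumes "q \<noteq> 0" "r = to_fract p / to_fract q" "degree p \<le> degree q"
  shows "rf_proper r"
proof (cases "rf_num r = 0")
  case False
  have eq: "rf_num r * q = p * rf_den r"
    using assms(1,2) by (rule rf_fraction_cross_mult)
  with False assms(1) have "p \<noteq> 0"
    by auto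
  hence "degree (rf_num r) + degree q = degree p + degree (rf_den r)"
    using eq False assms(1) by (metis degree_mult_eq rf_den_nonzero)
  thus ?thesis
    using assms(3) by (simp add: rf_proper_def)
qed (simp add: rf_proper_def)

lemma rf_properE:
  assumes "rf_proper r"
  obtains p q where "q \<noteq> 0" "r = to_fract p / to_fract q" "degree p \<le> degree q"
  using that[of "rf_den r" "rf_num r"] assms rf_eq_num_div_den[of r] by (simp add: rf_proper_def)

lemma rf_proper_mult:
  assumes "rf_proper r" "rf_proper s"
  shows "rf_proper (r * s)"
proof -
  from assms(1) obtain p q where 1: "q \<noteq> 0" "r = to_fract p / to_fract q" "degree p \<le> degree q"
    by (rule rf_properE)
  from assms(2) obtain p' q' where 2: "q' \<noteq> 0" "s = to_fract p' / to_fract q'" "degree p' \<le> degree q'"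
    by (rule rf_properE)
  show ?thesis
  proof (rule rf_proper_fraction)
    show "r * s = to_fract (p * p') / to_fract (q * q')"
      using 1(2) 2(2) by simp
    show "degree (p * p') \<le> degree (q * q')"
      using 1 2 degree_mult_le[of p p'] by (simp add: degree_mult_eq)
  qed (use 1 2 in simp)
qed

lemma rf_proper_add:
  assumes "rf_proper r" "rf_proper s"
  shows "rf_proper (r + s)"
proof -
  from assms(1) obtain p q where 1: "q \<noteq> 0" "r = to_fract p / to_fract q" "degree p \<le> degree q"
    by (rule rf_properE)
  from assms(2) obtain p' q' where 2: "q' \<noteq> 0" "s = to_fract p' / to_fract q'" "degree p' \<le> degree q'"
    by (rule rf_properE)
  show ?thesis
  proof (rule rf_proper_fraction)
    show "r + s = to_fract (p * q' + p' * q) / to_fract (q * q')"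
      using 1 2 by (simp add: add_frac_eq)
    have "degree (p * q') \<le> degree q + degree q'" "degree (p' * q) \<le> degree q + degree q'"
      using 1 2 degree_mult_le[of p q'] degree_mult_le[of p' q] by linarith+
    thus "degree (p * q' + p' * q) \<le> degree (q * q')"
      using 1 2 by (simp add: degree_mult_eq degree_add_le)
  qed (use 1 2 in simp)
qed

lemma rf_proper_0: "rf_proper 0"
  by (rule rf_proper_fraction[of 1 0 0]) auto

lemma rf_proper_sum: "(\<And>i. i \<in> I \<Longrightarrow> rf_proper (r i)) \<Longrightarrow> rf_proper (\<Sum>i\<in>I. r i)"
  by (induction I rule: infinite_finite_induct) (auto intro: rf_proper_0 rf_proper_add)

text \<open>
  Stability in the sense of having values on all of \<open>|z| \<ge> 1\<close> includes the absence of poles on the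
  circle, hence membership in \<^const>\<open>RL_inf\<close>; in this form closure under products is immediate.
\<close>

lemma RH_inf_iff:
  "G \<in> RH_inf \<longleftrightarrow> (\<forall>i j. rf_proper (G $ i $ j)) \<and> (\<forall>z. cmod z \<ge> 1 \<longrightarrow> (\<exists>M. tf_has_value G z M))"
    (is "_ = (?proper \<and> ?stable)")
proof (intro iffI conjI)
  assume G: "G \<in> RH_inf"
  thus ?proper
    by (simp add: RH_inf_def)
  show ?stable
  proof (intro allI impI exI)
    fix z :: complex assume "1 \<le> cmod z"
    thus "tf_has_value G z (tf_eval G z)"
      using G by (force simp: RH_inf_def tf_has_value_def rf_has_value_def tf_eval_def)
  qed
next
  assume *: "?proper \<and> ?stable"
  hence "G \<in> RL_inf"
    by (intro RL_infI) auto
  moreover have "cmod z < 1" if "rf_pole (G $ i $ j) z" for z i j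
  proof (rule ccontr)
    assume "\<not> cmod z < 1"
    with * obtain M where "tf_has_value G z M"
      by (meson not_less)
    thus False
      using that by (simp add: tf_has_value_def rf_has_value_def)
  qed
  ultimately show "G \<in> RH_inf"
    using * by (simp add: RH_inf_def)
qed

lemma RH_inf_mult:
  assumes "G \<in> RH_inf" "H \<in> RH_inf"
  shows "G ** H \<in> RH_inf"
  unfolding RH_inf_iff
proof (intro conjI allI impI)
  show "rf_proper ((G ** H) $ i $ j)" for i j
    using assms by (auto simp: RH_inf_iff matrix_matrix_mult_def intro!: rf_proper_sum rf_proper_mult)
  show "\<exists>M. tf_has_value (G ** H) z M" if "1 \<le> cmod z" for z
    using assms that unfolding RH_inf_iff by (meson tf_has_value_mult)
qed

lemma RH_inf_0: "0 \<in> RH_inf"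
proof -
  have "tf_has_value 0 z 0" for z
    by (simp add: tf_has_value_def rf_has_value_0)
  thus ?thesis
    by (auto simp: RH_inf_iff rf_proper_0)
qed

section \<open>The orthogonal splitting of the error\<close>

lemma norm_vector_scale: "norm (c *s (v :: complex ^ 'n)) = cmod c * norm v"
proof -
  have "(norm (c *s v))\<^sup>2 = (cmod c * norm v)\<^sup>2"
    by (simp add: norm_vec_def L2_set_def norm_mult power_mult_distrib sum_nonneg
        flip: sum_distrib_left)
  thus ?thesis
    by (simp add: power2_eq_iff_nonneg)
qed

lemma scaled_matrix_vector_mul: "map_matrix (\<lambda>g. c * g) M *v x = c *s (M *v (x :: complex ^ 'n))"
  by (simp add: vec_eq_iff matrix_vector_mult_def sum_distrib_left mult.assoc)

lemma power2_norm_matrix_vector_mul: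
  "(norm (M *v x))\<^sup>2 = x \<bullet> ((adjoint_mat M ** M) *v x)"
  by (simp only: power2_norm_eq_inner inner_adjoint_mat matrix_vector_mul_assoc)

lemma norm_isometry:
  assumes "adjoint_mat M ** M = mat 1"
  shows "norm (M *v x) = norm x"
proof -
  have "(norm (M *v x))\<^sup>2 = (norm x)\<^sup>2"
    unfolding power2_norm_matrix_vector_mul assms by (simp add: power2_norm_eq_inner)
  thus ?thesis
    by (simp add: power2_eq_iff_nonneg)
qed

text \<open>
  Pythagoras: \<open>M M\<^sup>*\<close> is the orthogonal projection onto the range of the isometry \<open>M\<close>, so \<open>a\<close> minus
  its projection is orthogonal to every difference of two vectors in that range.
\<close>

lemma isometry_orthogonal_split:
  fixes M :: "complex ^ 'p ^ 'm"
  assumes M: "adjoint_mat M ** M = mat 1"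
  shows "(norm (a - M *v b))\<^sup>2 =
    (norm (a - M *v (adjoint_mat M *v a)))\<^sup>2 + (norm (adjoint_mat M *v a - b))\<^sup>2"
proof -
  define r where "r = a - M *v (adjoint_mat M *v a)"
  define w where "w = adjoint_mat M *v a - b"
  have "adjoint_mat M *v r = 0"
    by (simp only: r_def matrix_vector_mult_diff_distrib matrix_vector_mul_assoc M
        matrix_mul_lid matrix_mul_assoc diff_self)
  hence "(M *v w) \<bullet> r = 0"
    by (simp add: inner_adjoint_mat)
  moreover have "a - M *v b = r + M *v w"
    by (simp add: r_def w_def matrix_vector_mult_diff_distrib)
  ultimately have "(norm (a - M *v b))\<^sup>2 = (norm r)\<^sup>2 + (norm (M *v w))\<^sup>2"
    by (simp add: power2_norm_eq_inner inner_add_left inner_add_right inner_commute)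
  thus ?thesis
    by (simp add: norm_isometry[OF M] r_def w_def)
qed

lemma matrix_inv_has_value:
  fixes F :: "ratfun ^ 'n ^ 'n"
  assumes "invertible F" "F \<in> RL_inf" "matrix_inv F \<in> RL_inf" "cmod z = 1"
  shows "tf_eval F z ** tf_eval (matrix_inv F) z = mat 1" "tf_eval (matrix_inv F) z ** tf_eval F z = mat 1"
proof -
  have "tf_has_value (mat 1) z (tf_eval F z ** tf_eval (matrix_inv F) z)"
    using tf_has_value_mult[OF RL_inf_has_value[OF assms(2,4)] RL_inf_has_value[OF assms(3,4)]]
    by (simp only: matrix_inv_right[OF assms(1)])
  moreover have "tf_has_value (mat 1) z (tf_eval (matrix_inv F) z ** tf_eval F z)"
    using tf_has_value_mult[OF RL_inf_has_value[OF assms(3,4)] RL_inf_has_value[OF assms(2,4)]]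
    by (simp only: matrix_inv_left[OF assms(1)])
  moreover have "tf_has_value (mat 1) z (mat 1)"
    by (rule tf_has_value_mat) (rule rf_has_value_1)
  ultimately show "tf_eval F z ** tf_eval (matrix_inv F) z = mat 1"
    "tf_eval (matrix_inv F) z ** tf_eval F z = mat 1"
    by (metis tf_has_value_eval)+
qed

lemma spectral_factor_identity:
  assumes F: "bistable_spectral_factor (mat (rf_const (\<gamma>\<^sup>2)) - para_conj Y ** Y) F"
    and Y: "Y \<in> RL_inf" and z: "cmod z = 1"
  shows "(norm (tf_eval F z *v x))\<^sup>2 = \<gamma>\<^sup>2 * (norm x)\<^sup>2 - (norm (tf_eval Y z *v x))\<^sup>2"
proof -
  define f y where "f = tf_eval F z" and "y = tf_eval Y z"
  have F': "F \<in> RL_inf" "para_conj F ** F = mat (rf_const (\<gamma>\<^sup>2)) - para_conj Y ** Y"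
    using F RH_inf_subset_RL_inf by (auto simp: bistable_spectral_factor_def)
  have FY: "tf_has_value F z f" "tf_has_value Y z y"
    using F'(1) Y z by (auto simp: f_def y_def RL_inf_has_value)
  have "tf_has_value (para_conj F ** F) z (adjoint_mat f ** f)"
    by (intro tf_has_value_mult tf_has_value_para_conj FY z)
  moreover have "tf_has_value (mat (rf_const (\<gamma>\<^sup>2)) - para_conj Y ** Y) z
      (mat (of_real (\<gamma>\<^sup>2)) - adjoint_mat y ** y)"
    by (intro tf_has_value_diff tf_has_value_mult tf_has_value_para_conj tf_has_value_mat
        rf_has_value_const FY z)
  ultimately have "adjoint_mat f ** f = mat (of_real (\<gamma>\<^sup>2)) - adjoint_mat y ** y"
    unfolding F'(2) by (metis tf_has_value_eval)
  moreover have "mat (complex_of_real (\<gamma>\<^sup>2)) *v x = \<gamma>\<^sup>2 *\<^sub>R x"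
    by (simp only: mat_vector_mul of_real_vector_scale)
  ultimately show ?thesis
    unfolding f_def[symmetric] y_def[symmetric] power2_norm_matrix_vector_mul[of f]
      power2_norm_matrix_vector_mul[of y]
    by (simp add: matrix_vector_mult_diff_rdistrib inner_diff_right power2_norm_eq_inner)
qed

text \<open>
  The model-matching problem for an arbitrary \<open>T1\<close> without poles on the unit circle and a \<open>T2\<close> that
  is given by its inner-outer factors as \<open>Ui ** Uo\<close>.
\<close>

locale model_matching =
  fixes T1 :: "ratfun ^ 'p1 ^ 'm"
    and Ui :: "ratfun ^ 'p2 ^ 'm"
    and Uo :: "ratfun ^ 'p2 ^ 'p2"
    and Y :: "ratfun ^ 'p1 ^ 'm"
    and N :: nat
  assumes T1: "T1 \<in> RL_inf"
    and factorization: "inner_outer (Ui ** Uo) Ui Uo"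
    and Y: "Y = (mat 1 - Ui ** para_conj Ui) ** T1"
begin

definition error :: "ratfun ^ 'p1 ^ 'p2 \<Rightarrow> ratfun ^ 'p1 ^ 'p2 \<Rightarrow> ratfun ^ 'p1 ^ 'm" where
  "error V D = T1 - (Ui ** Uo) ** V - tf_scale (1 / rf_z ^ N) (Ui ** Uo) ** D"

text \<open>The matrix called \<open>Rhat\<close> in the theorem, for an arbitrary spectral factor \<open>F\<close>.\<close>

definition reduced_data :: "ratfun ^ 'p1 ^ 'p1 \<Rightarrow> ratfun ^ 'p1 ^ 'p2 \<Rightarrow> ratfun ^ 'p1 ^ 'p2" where
  "reduced_data F V = tf_scale (rf_z ^ N) (para_conj Ui ** T1 ** matrix_inv F)
     - Uo ** tf_scale (rf_z ^ N) V ** matrix_inv F"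

lemma Ui: "Ui \<in> RL_inf" and Uo: "Uo \<in> RL_inf"
  using factorization RH_inf_subset_RL_inf by (auto simp: inner_outer_def)

lemma Y_in_RL_inf: "Y \<in> RL_inf"
  unfolding Y by (intro RL_inf_mult RL_inf_diff RL_inf_mat_1 RL_inf_para_conj Ui T1)

lemma error_in_RL_inf: "V \<in> RL_inf \<Longrightarrow> D \<in> RL_inf \<Longrightarrow> error V D \<in> RL_inf"
  unfolding error_def by (intro RL_inf_mult RL_inf_diff RL_inf_delay Ui Uo T1)

lemma reduced_data_in_RL_inf:
  "V \<in> RL_inf \<Longrightarrow> matrix_inv F \<in> RL_inf \<Longrightarrow> reduced_data F V \<in> RL_inf"
  unfolding reduced_data_def
  by (intro RL_inf_mult RL_inf_diff RL_inf_advance RL_inf_para_conj Ui Uo T1)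

context
  fixes V D :: "ratfun ^ 'p1 ^ 'p2" and z :: complex
  assumes V: "V \<in> RL_inf" and D: "D \<in> RL_inf" and z: "cmod z = 1"
begin

text \<open>
  The vector \<open>W x\<close> with \<open>W = Ui\<^sup>~ T1 - Uo (V + z\<^sup>-\<^sup>N D)\<close>: the coordinates of \<open>E x\<close> in the range of \<open>Ui\<close>,
  which are the only part of the error that \<open>V\<close> and \<open>D\<close> influence.
\<close>

definition residual :: "complex ^ 'p1 \<Rightarrow> complex ^ 'p2" where
  "residual x = adjoint_mat (tf_eval Ui z) *v (tf_eval T1 z *v x)
     - (tf_eval Uo z *v (tf_eval V z *v x) + inverse (z ^ N) *s (tf_eval Uo z *v (tf_eval D z *v x)))"

lemma circle_values:
  "tf_has_value T1 z (tf_eval T1 z)" "tf_has_value Ui z (tf_eval Ui z)" "tf_has_value Uo z (tf_eval Uo z)"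
  "tf_has_value V z (tf_eval V z)" "tf_has_value D z (tf_eval D z)"
  by (simp_all add: RL_inf_has_value T1 Ui Uo V D z)

lemma inner_value: "adjoint_mat (tf_eval Ui z) ** tf_eval Ui z = mat 1"
proof -
  have "para_conj Ui ** Ui = mat 1"
    using factorization by (simp add: inner_outer_def)
  hence "tf_has_value (mat 1) z (adjoint_mat (tf_eval Ui z) ** tf_eval Ui z)"
    using tf_has_value_mult[OF tf_has_value_para_conj[OF circle_values(2) z] circle_values(2)] by simp
  moreover have "tf_has_value (mat 1) z (mat 1)"
    by (rule tf_has_value_mat) (rule rf_has_value_1)
  ultimately show ?thesis
    by (metis tf_has_value_eval)
qed

lemma error_pythagoras:
  "(norm (tf_eval (error V D) z *v x))\<^sup>2 = (norm (tf_eval Y z *v x))\<^sup>2 + (norm (residual x))\<^sup>2"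
proof -
  define t u o' v d where "t = tf_eval T1 z" and "u = tf_eval Ui z" and "o' = tf_eval Uo z"
    and "v = tf_eval V z" and "d = tf_eval D z"
  note vals = circle_values[folded t_def u_def o'_def v_def d_def]
  have "tf_has_value (error V D) z
      (t - (u ** o') ** v - map_matrix (\<lambda>g. inverse (z ^ N) * g) (u ** o') ** d)"
    unfolding error_def
    by (intro tf_has_value_diff tf_has_value_mult tf_has_value_scale vals rf_has_value_inverse_delay z)
  hence "tf_eval (error V D) z *v x =
      t *v x - u *v (o' *v (v *v x)) - inverse (z ^ N) *s (u *v (o' *v (d *v x)))"
    by (simp only: tf_has_value_eval matrix_vector_mult_diff_rdistrib scaled_matrix_vector_mul
        flip: matrix_vector_mul_assoc)
  also have "\<dots> = t *v x - u *v (o' *v (v *v x) + inverse (z ^ N) *s (o' *v (d *v x)))"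
    by (simp add: matrix_vector_right_distrib vector_scalar_commute)
  finally have e: "tf_eval (error V D) z *v x = \<dots>" .
  have "tf_has_value Y z ((mat 1 - u ** adjoint_mat u) ** t)"
    unfolding Y
    by (intro tf_has_value_diff tf_has_value_mult tf_has_value_mat rf_has_value_1
        tf_has_value_para_conj vals z)
  hence y: "tf_eval Y z *v x = t *v x - u *v (adjoint_mat u *v (t *v x))"
    by (simp only: tf_has_value_eval matrix_vector_mult_diff_rdistrib matrix_vector_mul_lid
        flip: matrix_vector_mul_assoc)
  show ?thesis
    unfolding e y residual_def t_def[symmetric] u_def[symmetric] o'_def[symmetric]
      v_def[symmetric] d_def[symmetric]
    by (rule isometry_orthogonal_split) (use inner_value in \<open>simp add: u_def\<close>)
qed

text \<open>
  The factor \<open>z\<^sup>N\<close> turns \<open>z\<^sup>-\<^sup>N D\<close> into the stable matrix \<open>D\<close>, which is why the free parameter can be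
  absorbed into an element of \<^const>\<open>RH_inf\<close>; on the circle it does not change norms.
\<close>

lemma reduced_error_value:
  assumes F: "invertible F" "F \<in> RL_inf" "matrix_inv F \<in> RL_inf"
  shows "tf_eval (reduced_data F V - Uo ** D ** matrix_inv F) z *v (tf_eval F z *v x) = z ^ N *s residual x"
proof -
  define t u o' v d g where "t = tf_eval T1 z" and "u = tf_eval Ui z" and "o' = tf_eval Uo z"
    and "v = tf_eval V z" and "d = tf_eval D z" and "g = tf_eval (matrix_inv F) z"
  note vals = circle_values[folded t_def u_def o'_def v_def d_def]
    RL_inf_has_value[OF F(3) z, folded g_def]
  have zN: "rf_has_value (rf_z ^ N) z (z ^ N)"
    by (rule rf_has_value_power) (rule rf_has_value_z)
  have "tf_has_value (reduced_data F V - Uo ** D ** matrix_inv F) z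
      (map_matrix (\<lambda>g. z ^ N * g) (adjoint_mat u ** t ** g)
        - o' ** map_matrix (\<lambda>g. z ^ N * g) v ** g - o' ** d ** g)"
    unfolding reduced_data_def
    by (intro tf_has_value_diff tf_has_value_mult tf_has_value_scale tf_has_value_para_conj vals zN z)
  hence val: "tf_eval (reduced_data F V - Uo ** D ** matrix_inv F) z =
      map_matrix (\<lambda>g. z ^ N * g) (adjoint_mat u ** t ** g)
        - o' ** map_matrix (\<lambda>g. z ^ N * g) v ** g - o' ** d ** g"
    by (rule tf_has_value_eval)
  have cancel: "z ^ N * (inverse (z ^ N) * c) = c" for c
  proof -
    have "z \<noteq> 0"
      using z by auto
    thus ?thesis
      by simp
  qed
  have g: "g *v (tf_eval F z *v x) = x"
    using matrix_inv_has_value(2)[OF F z] by (simp add: g_def matrix_vector_mul_assoc)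
  have "tf_eval (reduced_data F V - Uo ** D ** matrix_inv F) z *v (tf_eval F z *v x) =
      z ^ N *s (adjoint_mat u *v (t *v x)) - o' *v (z ^ N *s (v *v x)) - o' *v (d *v x)"
    by (simp only: val matrix_vector_mult_diff_rdistrib scaled_matrix_vector_mul g
        flip: matrix_vector_mul_assoc)
  also have "\<dots> = z ^ N *s residual x"
    unfolding residual_def t_def[symmetric] u_def[symmetric] o'_def[symmetric]
      v_def[symmetric] d_def[symmetric]
    by (simp add: vector_scalar_commute vec_eq_iff algebra_simps cancel)
  finally show ?thesis .
qed

text \<open>
  The spectral factor replaces \<open>|Y x|\<^sup>2\<close> by \<open>\<gamma>\<^sup>2 |x|\<^sup>2 - |F x|\<^sup>2\<close> in the orthogonal splitting of the error.
  The bound \<open>\<gamma>\<close> on the error thereby becomes the bound \<open>1\<close> on the reduced error.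
\<close>

lemma model_matching_identity:
  assumes F: "bistable_spectral_factor (mat (rf_const (\<gamma>\<^sup>2)) - para_conj Y ** Y) F"
  shows "(norm (tf_eval (error V D) z *v x))\<^sup>2 + (norm (tf_eval F z *v x))\<^sup>2 =
    \<gamma>\<^sup>2 * (norm x)\<^sup>2 +
    (norm (tf_eval (reduced_data F V - Uo ** D ** matrix_inv F) z *v (tf_eval F z *v x)))\<^sup>2"
proof -
  have "invertible F" "F \<in> RL_inf" "matrix_inv F \<in> RL_inf"
    using F RH_inf_subset_RL_inf by (auto simp: bistable_spectral_factor_def)
  hence "norm (tf_eval (reduced_data F V - Uo ** D ** matrix_inv F) z *v (tf_eval F z *v x))
      = norm (residual x)"
    using z by (simp add: reduced_error_value norm_vector_scale norm_power)
  thus ?thesis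
    using spectral_factor_identity[OF F Y_in_RL_inf z, of x] error_pythagoras[of x] by simp
qed

end

context
  fixes V D :: "ratfun ^ 'p1 ^ 'p2"
  assumes V: "V \<in> RL_inf" and D: "D \<in> RL_inf"
begin

lemma hinf_norm_Y_le_error: "hinf_norm Y \<le> hinf_norm (error V D)"
proof (rule hinf_norm_le)
  fix z x assume z: "cmod z = 1"
  have "(norm (tf_eval Y z *v x))\<^sup>2 \<le> (norm (tf_eval (error V D) z *v x))\<^sup>2"
    using error_pythagoras[OF V D z, of x] by simp
  hence "norm (tf_eval Y z *v x) \<le> norm (tf_eval (error V D) z *v x)"
    by (rule power2_le_imp_le) simp
  also have "\<dots> \<le> hinf_norm (error V D) * norm x"
    by (rule norm_le_hinf_norm[OF error_in_RL_inf[OF V D] z])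
  finally show "norm (tf_eval Y z *v x) \<le> hinf_norm (error V D) * norm x" .
qed

lemma error_le_if_reduced_error_le_1:
  assumes F: "bistable_spectral_factor (mat (rf_const (\<gamma>\<^sup>2)) - para_conj Y ** Y) F"
    and \<gamma>: "\<gamma> \<ge> 0"
    and le: "hinf_norm (reduced_data F V - Uo ** D ** matrix_inv F) \<le> 1"
  shows "hinf_norm (error V D) \<le> \<gamma>"
proof (rule hinf_norm_le)
  fix z x assume z: "cmod z = 1"
  define K where "K = reduced_data F V - Uo ** D ** matrix_inv F"
  have "K \<in> RL_inf"
    unfolding K_def using F RH_inf_subset_RL_inf
    by (intro RL_inf_diff reduced_data_in_RL_inf RL_inf_mult V D Uo) (auto simp: bistable_spectral_factor_def)
  hence "norm (tf_eval K z *v (tf_eval F z *v x)) \<le> hinf_norm K * norm (tf_eval F z *v x)"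
    using z by (rule norm_le_hinf_norm)
  also have "\<dots> \<le> norm (tf_eval F z *v x)"
    using mult_right_mono[OF le norm_ge_zero] by (simp add: K_def)
  finally have "(norm (tf_eval K z *v (tf_eval F z *v x)))\<^sup>2 \<le> (norm (tf_eval F z *v x))\<^sup>2"
    by (intro power_mono) auto
  hence "(norm (tf_eval (error V D) z *v x))\<^sup>2 \<le> (\<gamma> * norm x)\<^sup>2"
    using model_matching_identity[OF V D z F, of x, folded K_def]
    unfolding power_mult_distrib by linarith
  thus "norm (tf_eval (error V D) z *v x) \<le> \<gamma> * norm x"
    by (rule power2_le_imp_le) (use \<gamma> in simp)
qed

text \<open>
  The gap \<open>\<gamma>\<^sup>2 - e\<^sup>2\<close> survives the change of variable \<open>y = F x\<close>, divided at worst by the square of a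
  bound for \<open>F\<close>. This uniformity over the circle is what yields a strict inequality for the supremum.
\<close>

lemma reduced_error_less_1_if_error_less:
  assumes F: "bistable_spectral_factor (mat (rf_const (\<gamma>\<^sup>2)) - para_conj Y ** Y) F"
    and less: "hinf_norm (error V D) < \<gamma>"
  shows "hinf_norm (reduced_data F V - Uo ** D ** matrix_inv F) < 1"
proof -
  define K where "K = reduced_data F V - Uo ** D ** matrix_inv F"
  define e where "e = hinf_norm (error V D)"
  \<comment> \<open>One is added only to have a positive bound to divide by.\<close>
  define b where "b = hinf_norm F + 1"
  define \<delta> where "\<delta> = (\<gamma>\<^sup>2 - e\<^sup>2) / b\<^sup>2"
  have F': "invertible F" "F \<in> RL_inf" "matrix_inv F \<in> RL_inf"
    using F RH_inf_subset_RL_inf by (auto simp: bistable_spectral_factor_def)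
  have b: "b > 0"
    using hinf_norm_nonneg[OF F'(2)] by (simp add: b_def)
  have e: "e \<ge> 0"
    using hinf_norm_nonneg[OF error_in_RL_inf[OF V D]] by (simp add: e_def)
  have gap: "\<gamma>\<^sup>2 - e\<^sup>2 > 0"
    using less e power_strict_mono[of e \<gamma> 2] by (simp add: e_def)
  hence \<delta>: "\<delta> > 0"
    using b by (simp add: \<delta>_def)
  have "hinf_norm K \<le> sqrt (1 - \<delta>)"
  proof (rule hinf_norm_le)
    fix z y assume z: "cmod z = 1"
    define x where "x = tf_eval (matrix_inv F) z *v y"
    have y: "y = tf_eval F z *v x"
      using matrix_inv_has_value(1)[OF F' z] by (simp add: x_def matrix_vector_mul_assoc)
    have "norm y \<le> hinf_norm F * norm x"
      unfolding y by (rule norm_le_hinf_norm[OF F'(2) z])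
    also have "\<dots> \<le> b * norm x"
      by (intro mult_right_mono) (auto simp: b_def)
    finally have "(norm y)\<^sup>2 \<le> b\<^sup>2 * (norm x)\<^sup>2"
      using power_mono[of "norm y" "b * norm x" 2] by (simp add: power_mult_distrib)
    hence "\<delta> * (norm y)\<^sup>2 \<le> \<delta> * (b\<^sup>2 * (norm x)\<^sup>2)"
      using \<delta> by (intro mult_left_mono) auto
    also have "\<dots> = (\<gamma>\<^sup>2 - e\<^sup>2) * (norm x)\<^sup>2"
      using b by (simp add: \<delta>_def)
    finally have "\<delta> * (norm y)\<^sup>2 \<le> \<gamma>\<^sup>2 * (norm x)\<^sup>2 - e\<^sup>2 * (norm x)\<^sup>2"
      by (simp add: algebra_simps)
    moreover have "(norm (tf_eval (error V D) z *v x))\<^sup>2 \<le> e\<^sup>2 * (norm x)\<^sup>2"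
      using power_mono[OF norm_le_hinf_norm[OF error_in_RL_inf[OF V D] z] norm_ge_zero, of x 2]
      by (simp add: e_def power_mult_distrib)
    ultimately have "(norm (tf_eval K z *v y))\<^sup>2 \<le> (1 - \<delta>) * (norm y)\<^sup>2"
      using model_matching_identity[OF V D z F, of x] by (simp add: K_def y algebra_simps)
    from real_sqrt_le_mono[OF this] show "norm (tf_eval K z *v y) \<le> sqrt (1 - \<delta>) * norm y"
      by (simp add: real_sqrt_mult)
  qed
  also have "\<dots> < 1"
    using \<delta> by simp
  finally show ?thesis
    by (simp add: K_def)
qed

end

end

section \<open>The optimal error and the distance to the stable matrices\<close>

lemma delay_space_nonempty:
  assumes "\<And>i. i < N \<Longrightarrow> subspace (S i)"
  shows "delay_space N S \<noteq> {}"
proof -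
  have "\<forall>i<N. 0 \<in> S i"
    using assms by (simp add: subspace_0)
  hence "(\<Sum>i<N. tf_scale (1 / rf_z ^ i) (tf_const 0)) \<in> delay_space N S"
    unfolding delay_space_def by (auto intro!: exI[of _ "\<lambda>_. 0"])
  thus ?thesis
    by blast
qed

theorem theorem3:
  fixes A :: "real ^ 'n ^ 'n"
    and B1 :: "real ^ 'p1 ^ 'n"
    and B2 :: "real ^ 'p2 ^ 'n"
    and C1 :: "real ^ 'n ^ 'm"
    and D12 :: "real ^ 'p2 ^ 'm"
    and T1 Y :: "ratfun ^ 'p1 ^ 'm"
    and T2 Ui T2hat :: "ratfun ^ 'p2 ^ 'm"
    and Uo :: "ratfun ^ 'p2 ^ 'p2"
    and N :: nat
    and YS :: "nat \<Rightarrow> (real ^ 'p1 ^ 'p2) set"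
    and YY :: "(ratfun ^ 'p1 ^ 'p2) set"
    and Yo :: "real \<Rightarrow> ratfun ^ 'p1 ^ 'p1"
    and R :: "real \<Rightarrow> ratfun ^ 'p1 ^ 'p2"
    and Rhat :: "real \<Rightarrow> ratfun ^ 'p1 ^ 'p2 \<Rightarrow> ratfun ^ 'p1 ^ 'p2"
    and T1hat :: "ratfun ^ 'p1 ^ 'p2 \<Rightarrow> ratfun ^ 'p1 ^ 'm"
    and \<alpha> :: real
  assumes N: "N \<ge> 1"
    and stable: "spectral_radius A < 1"
    and D12_pos: "\<And>x. x \<noteq> 0 \<Longrightarrow> x \<bullet> ((transpose D12 ** D12) *v x) > 0"
    and C1_D12: "transpose C1 ** D12 = 0"
    and T1: "T1 = ss_tf A B1 C1 0"
    and T2: "T2 = ss_tf A B2 C1 D12"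
    and factorization: "inner_outer T2 Ui Uo"
    and Y: "Y = (mat 1 - Ui ** para_conj Ui) ** T1"
    and Yo: "\<And>\<gamma>. \<gamma> > hinf_norm Y \<Longrightarrow>
      bistable_spectral_factor (mat (rf_const (\<gamma>\<^sup>2)) - para_conj Y ** Y) (Yo \<gamma>)"
    and R: "\<And>\<gamma>. R \<gamma> = para_conj Ui ** T1 ** matrix_inv (Yo \<gamma>)"
    and YS: "\<And>i. i < N \<Longrightarrow> subspace (YS i)"
    and YY: "YY = delay_space N YS"
    and Rhat: "\<And>\<gamma> V. Rhat \<gamma> V =
      tf_scale (rf_z ^ N) (R \<gamma>) - Uo ** tf_scale (rf_z ^ N) V ** matrix_inv (Yo \<gamma>)"
    and T1hat: "\<And>V. T1hat V = T1 - T2 ** V"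
    and T2hat: "T2hat = tf_scale (1 / rf_z ^ N) T2"
    and \<alpha>: "\<alpha> = Inf {hinf_norm (T1hat V - T2hat ** D) | D V. D \<in> RH_inf \<and> V \<in> YY}"
  shows "\<alpha> = Inf {\<gamma>. hinf_norm Y < \<gamma> \<and> (\<exists>V\<in>YY. dist_RH_inf (Rhat \<gamma> V) < 1)}
    \<and> (\<forall>\<gamma>>\<alpha>. \<forall>V\<in>YY. \<forall>D\<in>RH_inf. \<forall>X\<in>RH_inf.
          hinf_norm (Rhat \<gamma> V - X) \<le> 1 \<and> X = Uo ** D ** matrix_inv (Yo \<gamma>) \<longrightarrow>
          hinf_norm (T1hat V - T2hat ** D) \<le> \<gamma>)"
proof -
  have T2_eq: "T2 = Ui ** Uo"
    using factorization by (simp add: inner_outer_def)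
  interpret model_matching T1 Ui Uo Y N
  proof
    show "T1 \<in> RL_inf"
      unfolding T1 using stable by (rule ss_tf_in_RL_inf)
    show "inner_outer (Ui ** Uo) Ui Uo"
      using factorization by (simp only: T2_eq)
  qed (rule Y)
  have err: "T1hat V - T2hat ** D = error V D" for V D
    by (simp add: T1hat T2hat T2_eq error_def)
  have red: "Rhat \<gamma> V = reduced_data (Yo \<gamma>) V" for \<gamma> V
    by (simp add: Rhat R reduced_data_def)
  have YY_RL: "V \<in> RL_inf" if "V \<in> YY" for V
    using that delay_space_subset_RL_inf by (auto simp: YY)
  have RH_RL: "D \<in> RL_inf" if "D \<in> RH_inf" for D :: "ratfun ^ 'x ^ 'y"
    using that RH_inf_subset_RL_inf by auto
  define \<A> where "\<A> = {hinf_norm (error V D) | D V. D \<in> RH_inf \<and> V \<in> YY}"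
  define \<G> where "\<G> = {\<gamma>. hinf_norm Y < \<gamma> \<and> (\<exists>V\<in>YY. dist_RH_inf (Rhat \<gamma> V) < 1)}"
  have \<alpha>_eq: "\<alpha> = Inf \<A>"
    by (simp add: \<alpha> err \<A>_def)
  have Y_nonneg: "0 \<le> hinf_norm Y"
    by (rule hinf_norm_nonneg[OF Y_in_RL_inf])
  have Y_le: "hinf_norm Y \<le> a" if "a \<in> \<A>" for a
  proof -
    from that obtain D V where "a = hinf_norm (error V D)" "D \<in> RH_inf" "V \<in> YY"
      by (auto simp: \<A>_def)
    thus ?thesis
      using hinf_norm_Y_le_error[OF YY_RL RH_RL] by simp
  qed
  have bdd_A: "bdd_below \<A>"
    using Y_le by (rule bdd_belowI)
  have bdd_G: "bdd_below \<G>"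
    by (rule bdd_belowI[of _ "hinf_norm Y"]) (auto simp: \<G>_def)
  have "YY \<noteq> {}"
    unfolding YY by (rule delay_space_nonempty) (rule YS)
  then obtain V0 where V0: "V0 \<in> YY"
    by auto
  have "hinf_norm (error V0 0) \<in> \<A>"
    unfolding \<A>_def using V0 RH_inf_0 by blast
  hence A_nonempty: "\<A> \<noteq> {}"
    by auto
  hence Y_le_\<alpha>: "hinf_norm Y \<le> \<alpha>"
    unfolding \<alpha>_eq using Y_le by (rule cInf_greatest)
  \<comment> \<open>Every \<open>\<gamma>\<close> above an achievable error satisfies the distance condition, with the same \<open>V\<close>.\<close>
  have in_G: "\<gamma> \<in> \<G>" if "a \<in> \<A>" "a < \<gamma>" for a \<gamma>
  proof -
    from that(1) obtain D V where a: "a = hinf_norm (error V D)" and D: "D \<in> RH_inf" and V: "V \<in> YY"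
      by (auto simp: \<A>_def)
    have \<gamma>: "hinf_norm Y < \<gamma>"
      using Y_le[OF that(1)] that(2) by simp
    note F = Yo[OF \<gamma>]
    define X where "X = Uo ** D ** matrix_inv (Yo \<gamma>)"
    have X: "X \<in> RH_inf"
      unfolding X_def using F factorization D
      by (intro RH_inf_mult) (auto simp: bistable_spectral_factor_def inner_outer_def)
    have Rhat_RL: "Rhat \<gamma> V \<in> RL_inf"
      unfolding red using F
      by (intro reduced_data_in_RL_inf YY_RL V RH_RL) (auto simp: bistable_spectral_factor_def)
    have "bdd_below {hinf_norm (Rhat \<gamma> V - X) | X. X \<in> RH_inf}"
      by (rule bdd_belowI[of _ 0]) (auto intro: hinf_norm_nonneg RL_inf_diff[OF Rhat_RL RH_RL])
    hence "dist_RH_inf (Rhat \<gamma> V) \<le> hinf_norm (Rhat \<gamma> V - X)"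
      unfolding dist_RH_inf_def by (intro cInf_lower) (use X in auto)
    also have "\<dots> < 1"
      unfolding red X_def
      by (rule reduced_error_less_1_if_error_less[OF YY_RL[OF V] RH_RL[OF D] F]) (use a that(2) in simp)
    finally show ?thesis
      using \<gamma> V by (auto simp: \<G>_def)
  qed
  \<comment> \<open>Conversely, a good approximation \<open>X\<close> is of the form \<open>Uo D Yo\<^sup>-\<^sup>1\<close>, and this \<open>D\<close> achieves \<open>\<gamma>\<close>.\<close>
  have \<alpha>_le: "\<alpha> \<le> \<gamma>" if "\<gamma> \<in> \<G>" for \<gamma>
  proof -
    from that obtain V where \<gamma>: "hinf_norm Y < \<gamma>" and V: "V \<in> YY" and dist: "dist_RH_inf (Rhat \<gamma> V) < 1"
      by (auto simp: \<G>_def)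
    have "{hinf_norm (Rhat \<gamma> V - X) | X. X \<in> RH_inf} \<noteq> {}"
      using RH_inf_0 by blast
    from cInf_lessD[OF this dist[unfolded dist_RH_inf_def]]
    obtain X where X: "X \<in> RH_inf" and less: "hinf_norm (Rhat \<gamma> V - X) < 1"
      by auto
    note F = Yo[OF \<gamma>]
    have F': "invertible (Yo \<gamma>)" and U: "invertible Uo"
      using F factorization by (auto simp: bistable_spectral_factor_def inner_outer_def)
    define D where "D = matrix_inv Uo ** X ** Yo \<gamma>"
    have D: "D \<in> RH_inf"
      unfolding D_def using F factorization X
      by (intro RH_inf_mult) (auto simp: bistable_spectral_factor_def inner_outer_def)
    have "Uo ** D ** matrix_inv (Yo \<gamma>) = (Uo ** matrix_inv Uo) ** X ** (Yo \<gamma> ** matrix_inv (Yo \<gamma>))"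
      by (simp add: D_def matrix_mul_assoc)
    hence "Uo ** D ** matrix_inv (Yo \<gamma>) = X"
      by (simp add: matrix_inv_right F' U)
    hence "hinf_norm (error V D) \<le> \<gamma>"
      using error_le_if_reduced_error_le_1[OF YY_RL[OF V] RH_RL[OF D] F] less \<gamma> Y_nonneg
      by (simp add: red)
    moreover have "\<alpha> \<le> hinf_norm (error V D)"
      unfolding \<alpha>_eq by (rule cInf_lower[OF _ bdd_A]) (use D V in \<open>auto simp: \<A>_def\<close>)
    ultimately show ?thesis
      by simp
  qed
  have "\<alpha> = Inf \<G>"
  proof (rule antisym)
    obtain a where "a \<in> \<A>"
      using A_nonempty by blast
    hence "a + 1 \<in> \<G>"
      by (rule in_G) simp
    hence "\<G> \<noteq> {}"
      by blast
    thus "\<alpha> \<le> Inf \<G>"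
      using \<alpha>_le by (rule cInf_greatest)
    have "Inf \<G> \<le> a" if "a \<in> \<A>" for a
    proof (rule dense_ge)
      fix \<gamma> assume "a < \<gamma>"
      thus "Inf \<G> \<le> \<gamma>"
        using in_G[OF that] bdd_G by (intro cInf_lower)
    qed
    thus "Inf \<G> \<le> \<alpha>"
      unfolding \<alpha>_eq using A_nonempty by (intro cInf_greatest)
  qed
  moreover have "hinf_norm (error V D) \<le> \<gamma>"
    if "\<gamma> > \<alpha>" "V \<in> YY" "D \<in> RH_inf" "hinf_norm (Rhat \<gamma> V - Uo ** D ** matrix_inv (Yo \<gamma>)) \<le> 1"
    for \<gamma> V D
  proof -
    have "hinf_norm Y < \<gamma>"
      using Y_le_\<alpha> that(1) by simp
    thus ?thesis
      using error_le_if_reduced_error_le_1[OF YY_RL[OF that(2)] RH_RL[OF that(3)] Yo] that(4) Y_nonneg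
      by (simp add: red)
  qed
  ultimately show ?thesis
    unfolding \<G>_def err by blast
qed

end
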